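(* Let $\alpha>0$, $t_0>0$, $x_0\in\mathcal H$, and let $x:[t_0,+\infty)\to\mathcal H$ be a solution of the Cauchy problem $$\tfrac{\alpha}{t}\dot x(t)+\operatorname{proj}_{C(x(t))+\ddot x(t)}(0)=0\ (t>t_0),\qquad x(t_0)=x_0,\ \dot x(t_0)=0 .$$ Assume that every $f_i$ is bounded from below and that the Assumption on the weak Pareto set stated in the context holds. Define $$\mathcal W(t)=u_0(x(t))+\tfrac12\|\dot x(t)\|^2=\sup_{z\in\mathcal H}\min_{i=1,\dots,m}\big(f_i(x(t))-f_i(z)\big)+\tfrac12\|\dot x(t)\|^2 .$$ Then $\lim_{t\to+\infty}\mathcal W(t)=0$. Hence $\lim_{t\to+\infty}u_0(x(t))=0$, and every weak limit point of $x$ is Pareto critical.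
   Context: $\mathcal H$ is a real Hilbert space. $f_1,\dots,f_m:\mathcal H\to\mathbb R$ are convex and continuously differentiable, and $F=(f_1,\dots,f_m)$. $C(x)=\operatorname{co}\{\nabla f_i(x):i=1,\dots,m\}$. For a closed convex $K\subset\mathcal H$, $\operatorname{proj}_K(y)=\arg\min_{w\in K}\|w-y\|^2$. A solution of the Cauchy problem is a function $x:[t_0,+\infty)\to\mathcal H$ such that: $x\in C^1([t_0,+\infty))$; $\dot x$ is absolutely continuous on $[t_0,T]$ for every $T\ge t_0$; there is a Bochner measurable $\ddot x:[t_0,+\infty)\to\mathcal H$ with $\dot x(t)=\dot x(t_0)+\int_{t_0}^t\ddot x(s)\,ds$ for all $t$, and $\frac{d}{dt}\dot x=\ddot x$ a.e.; the equation holds for almost all $t\ge t_0$; and the initial conditions hold. A point $x^*$ is weakly Pareto optimal if there is no $x\in\mathcal H$ with $f_i(x)<f_i(x^* )$ for all $i$; $P_w$ denotes the set of such points. A point $x^*$ is Pareto critical if $0\in C(x^* )$. The merit function is $u_0(x)=\sup_{z\in\mathcal H}\min_{i}\big(f_i(x)-f_i(z)\big)$. For $\hat F\in\mathbb R^m$, $\mathcal L(\hat F)=\{x:F(x)\le\hat F\}$ (componentwise) and $P_w(\hat F)=P_w\cap\mathcal L(\hat F)$. Assumption: for all $x_0\in\mathcal H$ and all $x\in\mathcal L(F(x_0))$ there exists $x^*\in P_w(F(x))$, and $$R:=\sup_{F^*\in F(P_w(F(x_0)))}\ \inf_{x\in F^{-1}(F^* )}\tfrac12\|x-x_0\|^2<+\infty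 .$$ *)

theory Defs
  imports "HOL-Analysis.Analysis"
begin

definition proj :: "'a::real_inner set \<Rightarrow> 'a \<Rightarrow> 'a" where
  "proj K y = (THE w. w \<in> K \<and> (\<forall>v\<in>K. norm (w - y) \<le> norm (v - y)))"

text \<open>C(x) = co { grad f_i(x) }, with gradients given by g.\<close>
definition Cset :: "('i::finite \<Rightarrow> 'a::real_inner \<Rightarrow> 'a) \<Rightarrow> 'a \<Rightarrow> 'a set" where
  "Cset g x = convex hull (range (\<lambda>i. g i x))"

definition abs_cont_on :: "real \<Rightarrow> real \<Rightarrow> (real \<Rightarrow> 'a::real_normed_vector) \<Rightarrow> bool" where
  "abs_cont_on a b h \<longleftrightarrow>
     (\<forall>\<epsilon>>0. \<exists>\<delta>>0. \<forall>D. finite D \<and> (\<forall>(u,v)\<in>D. a \<le> u \<and> u < v \<and> v \<le> b) \<and>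
        pairwise (\<lambda>(u,v) (u',v'). {u<..<v} \<inter> {u'<..<v'} = {}) D \<and>
        (\<Sum>(u,v)\<in>D. v - u) < \<delta> \<longrightarrow> (\<Sum>(u,v)\<in>D. norm (h v - h u)) < \<epsilon>)"

definition u0 :: "('i::finite \<Rightarrow> 'a \<Rightarrow> real) \<Rightarrow> 'a \<Rightarrow> real" where
  "u0 f x = (SUP z. Min (range (\<lambda>i. f i x - f i z)))"

definition weak_pareto :: "('i \<Rightarrow> 'a \<Rightarrow> real) \<Rightarrow> 'a set" where
  "weak_pareto f = {xs. \<not> (\<exists>x. \<forall>i. f i x < f i xs)}"

definition level :: "('i \<Rightarrow> 'a \<Rightarrow> real) \<Rightarrow> ('i \<Rightarrow> real) \<Rightarrow> 'a set" where
  "level f Fh = {x. \<forall>i. f i x \<le> Fh i}"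

definition pareto_critical :: "('i::finite \<Rightarrow> 'a::real_inner \<Rightarrow> 'a) \<Rightarrow> 'a \<Rightarrow> bool" where
  "pareto_critical g x \<longleftrightarrow> 0 \<in> Cset g x"

definition is_solution ::
  "('i::finite \<Rightarrow> 'a::{real_inner,complete_space} \<Rightarrow> 'a) \<Rightarrow> real \<Rightarrow> real \<Rightarrow> 'a
   \<Rightarrow> (real \<Rightarrow> 'a) \<Rightarrow> (real \<Rightarrow> 'a) \<Rightarrow> (real \<Rightarrow> 'a) \<Rightarrow> bool" where
  "is_solution g \<alpha> t0 x0 x x' x'' \<longleftrightarrow>
     (\<forall>t\<ge>t0. (x has_vector_derivative x' t) (at t within {t0..})) \<and>
     continuous_on {t0..} x' \<and>
     (\<forall>T\<ge>t0. abs_cont_on t0 T x') \<and>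
     (\<forall>t\<ge>t0. (x'' has_integral (x' t - x' t0)) {t0..t}) \<and>
     (AE t in lborel. t > t0 \<longrightarrow> (x' has_vector_derivative x'' t) (at t)) \<and>
     (AE t in lborel. t > t0 \<longrightarrow>
        (\<alpha> / t) *\<^sub>R x' t + proj ((\<lambda>c. c + x'' t) ` Cset g (x t)) 0 = 0) \<and>
     x t0 = x0 \<and> x' t0 = 0"

end

theory Submission
  imports Defs
begin

text \<open>
  The variational inequality of the projection gives, for every \<open>i\<close>, that \<open>f\<^sub>i(x) + \<parallel>x'\<parallel>\<^sup>2 / 2\<close> decreases
  at rate at least \<open>(\<alpha>/t) \<parallel>x'\<parallel>\<^sup>2\<close>; hence \<open>x'\<close> is bounded and \<open>\<parallel>x'\<parallel>\<^sup>2 / t\<close> is integrable. For fixed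
  \<open>z\<close>, convexity and \<open>- (x'' + (\<alpha>/t) x') \<in> C(x)\<close> give for \<open>h = \<parallel>x - z\<parallel>\<^sup>2 / 2\<close> the inequality
  \<open>h'' + (\<alpha>/t) h' + W\<^sub>z \<le> 3/2 \<parallel>x'\<parallel>\<^sup>2\<close>, where \<open>W\<^sub>z = min\<^sub>i (f\<^sub>i(x) - f\<^sub>i(z)) + \<parallel>x'\<parallel>\<^sup>2 / 2\<close> is
  nonincreasing. Dividing by \<open>t\<close> and integrating by parts, all terms in \<open>h\<close> have a favourable sign or
  are bounded, so \<open>W\<^sub>z(T) ln (T/t0)\<close> is bounded in terms of \<open>\<parallel>z - x0\<parallel>\<close> only. The assumption on the
  weak Pareto set lets the supremum over \<open>z\<close> be taken over a bounded set, whence \<open>W(T) = O(1 / ln T)\<close>.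
  Weak limit points are weakly Pareto optimal by the gradient inequality, and then critical by
  separating 0 from \<open>C\<close>.
\<close>

section \<open>Absolutely continuous functions\<close>

text \<open>
  A tagged division is chosen so fine that pieces tagged outside the exceptional null set obey the
  derivative bound, while pieces tagged inside it lie in an open set of small measure, where absolute
  continuity applies.
\<close>

lemma abs_cont_on_AE_deriv_nonpos_imp_le:
  fixes \<phi> :: "real \<Rightarrow> real"
  assumes ac: "abs_cont_on a b \<phi>" and ab: "a \<le> b"
    and deriv: "AE t in lborel. a < t \<and> t < b \<longrightarrow> (\<exists>D\<le>0. (\<phi> has_real_derivative D) (at t))"
  shows "\<phi> b \<le> \<phi> a"
proof (rule field_le_epsilon)
  fix e :: real assume e: "0 < e"
  \<comment> \<open>Pieces tagged outside the null set will contribute at most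
    \<open>e' * (b - a)\<close> in total and those tagged inside it at most \<open>e'\<close>; this
    choice makes the two add up to \<open>e\<close>.\<close>
  define e' where "e' = e / (b - a + 1)"
  have e': "e' > 0" using e ab by (simp add: e'_def)
  have e'e: "e' * (b - a) + e' = e"
  proof -
    have "e' * (b - a + 1) = e" using ab by (simp add: e'_def)
    then show ?thesis by (simp add: algebra_simps)
  qed
  obtain \<delta> where \<delta>: "\<delta> > 0" and small: "\<And>D. finite D \<Longrightarrow> \<forall>(u,v)\<in>D. a \<le> u \<and> u < v \<and> v \<le> b \<Longrightarrow>
        pairwise (\<lambda>(u,v) (u',v'). {u<..<v} \<inter> {u'<..<v'} = {}) D \<Longrightarrow>
        (\<Sum>(u,v)\<in>D. v - u) < \<delta> \<Longrightarrow> (\<Sum>(u,v)\<in>D. norm (\<phi> v - \<phi> u)) < e'"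
    using ac e' unfolding abs_cont_on_def by meson
  obtain N0 where N0: "\<And>t. t \<notin> N0 \<Longrightarrow> a < t \<and> t < b \<longrightarrow> (\<exists>D\<le>0. (\<phi> has_real_derivative D) (at t))"
    and N0_null: "N0 \<in> null_sets lborel"
    using AE_E3[OF deriv] by auto
  \<comment> \<open>The derivative condition concerns the open interval only, so tags at the
    endpoints are treated as exceptional too.\<close>
  define N where "N = N0 \<union> {a, b}"
  have N_null: "N \<in> null_sets lebesgue"
  proof -
    have "N0 \<in> null_sets lebesgue" using N0_null by (simp add: null_sets_completionI)
    moreover have "{a,b} \<in> null_sets lebesgue"
      using negligible_iff_null_sets negligible_finite by blast
    ultimately show ?thesis unfolding N_def by (rule null_sets.Un)
  qed
  obtain G where G: "open G" "N \<subseteq> G" "G - N \<in> lmeasurable" "emeasure lebesgue (G - N) < ennreal \<delta>"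
    using sets_lebesgue_outer_open[OF null_setsD2[OF N_null] \<delta>] by blast
  have G_eq: "emeasure lebesgue G < ennreal \<delta>"
    using G(2,4) N_null emeasure_Diff_null_set[OF N_null, of G] \<open>open G\<close>
    by (metis lborelD_Collect borel_open emeasure_Diff_null_set sets_completionI_sets sets_lborel)
  have G_meas: "G \<in> lmeasurable"
    using G(1) G_eq by (auto simp: fmeasurable_def intro: order.strict_trans)
  have G_small: "measure lebesgue G < \<delta>"
    using G_eq \<delta> G_meas by (simp add: emeasure_eq_measure2 ennreal_less_iff)
  \<comment> \<open>Straddle estimate: the derivative bounds on the two sides of \<open>t\<close>
    are added, and what remains of the derivative itself is
    \<open>D * (v - u) \<le> 0\<close>.\<close>
  have "\<exists>d>0. \<forall>u v. u \<le> t \<and> t \<le> v \<and> \<bar>u - t\<bar> < d \<and> \<bar>v - t\<bar> < d \<longrightarrow> \<phi> v - \<phi> u \<le> e' * (v - u)"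
    if t: "t \<notin> N" "a \<le> t" "t \<le> b" for t
  proof -
    have "a < t" "t < b" "t \<notin> N0" using t by (auto simp: N_def)
    then obtain D where D: "D \<le> 0" "(\<phi> has_real_derivative D) (at t)" using N0 by blast
    then obtain d where d: "d > 0" "\<And>y. norm (y - t) < d \<Longrightarrow> norm (\<phi> y - \<phi> t - D * (y - t)) \<le> e' * norm (y - t)"
      using e' unfolding has_field_derivative_def has_derivative_at_alt by metis
    have "\<phi> v - \<phi> u \<le> e' * (v - u)" if "u \<le> t" "t \<le> v" "\<bar>u - t\<bar> < d" "\<bar>v - t\<bar> < d" for u v
    proof -
      have "\<phi> v - \<phi> t - D * (v - t) \<le> e' * (v - t)" using d(2)[of v] that by auto
      moreover have "- (\<phi> u - \<phi> t - D * (u - t)) \<le> e' * (t - u)" using d(2)[of u] that by auto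
      moreover have "D * (v - u) \<le> 0" using D that by (simp add: mult_nonpos_nonneg)
      ultimately show ?thesis by (simp add: algebra_simps)
    qed
    then show ?thesis using d(1) by blast
  qed
  then obtain d where d: "\<And>t. t \<notin> N \<Longrightarrow> a \<le> t \<Longrightarrow> t \<le> b \<Longrightarrow> d t > 0"
    "\<And>t u v. t \<notin> N \<Longrightarrow> a \<le> t \<Longrightarrow> t \<le> b \<Longrightarrow> u \<le> t \<Longrightarrow> t \<le> v \<Longrightarrow> \<bar>u - t\<bar> < d t \<Longrightarrow> \<bar>v - t\<bar> < d t \<Longrightarrow>
        \<phi> v - \<phi> u \<le> e' * (v - u)"
    by metis
  define \<gamma> where "\<gamma> t = (if t \<in> N then G else if a \<le> t \<and> t \<le> b then ball t (d t) else UNIV)" for t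
  have "gauge \<gamma>" unfolding gauge_def \<gamma>_def using G d by auto
  then obtain p where p: "p tagged_division_of {a..b}" "\<gamma> fine p"
    using fine_division_exists_real by blast
  note pD = tagged_division_ofD[OF p(1)]
  have box: "K = {Inf K..Sup K} \<and> Inf K \<le> t \<and> t \<le> Sup K \<and> a \<le> Inf K \<and> Sup K \<le> b \<and> K \<subseteq> \<gamma> t"
    if tK: "(t, K) \<in> p" for t K
  proof -
    obtain u v where K: "K = {u..v}" using pD(4)[OF tK] by auto
    have "t \<in> K" using pD(2)[OF tK] .
    moreover have "K \<subseteq> {a..b}" using pD(3)[OF tK] .
    moreover have "K \<subseteq> \<gamma> t" using p(2) tK by (rule fineD)
    ultimately show ?thesis using K by auto
  qed
  have ends: "Inf K \<le> Sup K" "a \<le> Inf K" "Sup K \<le> b" if "(t, K) \<in> p" for t K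
    using box[OF that] by linarith+
  \<comment> \<open>Degenerate pieces have zero increment. They are removed because
    \<open>abs_cont_on\<close> speaks of intervals with \<open>u < v\<close>, and because only
    nondegenerate pieces are determined by their endpoints.\<close>
  define p0 where "p0 = {(t,K) \<in> p. Inf K < Sup K}"
  define p1 where "p1 = {(t,K) \<in> p0. t \<in> N}"
  define p2 where "p2 = {(t,K) \<in> p0. t \<notin> N}"
  have fin: "finite p" "finite p0" "finite p1" "finite p2"
    using pD(1) by (auto simp: p0_def p1_def p2_def intro: rev_finite_subset)
  let ?F = "\<lambda>(t,K). \<phi> (Sup K) - \<phi> (Inf K)"
  let ?I = "\<lambda>(t::real, K::real set). (Inf K, Sup K)"
  have disj: "{Inf K<..<Sup K} \<inter> {Inf K'<..<Sup K'} = {}"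
    if "(t,K) \<in> p" "(t',K') \<in> p" "(t,K) \<noteq> (t',K')" for t K t' K'
  proof -
    have "interior K \<inter> interior K' = {}" using pD(5)[OF that] .
    moreover have "interior K = {Inf K<..<Sup K}" "interior K' = {Inf K'<..<Sup K'}"
      using box[OF that(1)] box[OF that(2)] by (metis interior_atLeastAtMost_real)+
    ultimately show ?thesis by simp
  qed
  have inj: "inj_on ?I p1"
  proof (rule inj_onI, rule ccontr)
    fix A B assume AB: "A \<in> p1" "B \<in> p1" "?I A = ?I B" "A \<noteq> B"
    obtain t K t' K' where [simp]: "A = (t,K)" "B = (t',K')" by (cases A, cases B)
    have "{Inf K<..<Sup K} \<inter> {Inf K'<..<Sup K'} = {}"
      using disj[of t K t' K'] AB by (auto simp: p1_def p0_def)
    then have "{Inf K<..<Sup K} = {}" using AB(3) by simp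
    moreover have "Inf K < Sup K" using AB(1) by (simp add: p1_def p0_def)
    ultimately show False by (metis greaterThanLessThan_empty_iff not_le)
  qed
  have "\<phi> b - \<phi> a = sum ?F p" using additive_tagged_division_1[OF ab p(1), of \<phi>] by simp
  also have "\<dots> = sum ?F p0"
  proof (rule sum.mono_neutral_right[OF fin(1)])
    show "p0 \<subseteq> p" by (auto simp: p0_def)
    show "\<forall>i\<in>p - p0. ?F i = 0"
      using ends(1) by (fastforce simp: p0_def)
  qed
  also have "\<dots> = sum ?F p1 + sum ?F p2"
  proof -
    have "p0 = p1 \<union> p2" "p1 \<inter> p2 = {}" by (auto simp: p1_def p2_def)
    then show ?thesis using fin by (simp add: sum.union_disjoint)
  qed
  also have "sum ?F p1 \<le> e'"
  proof -
    define D where "D = ?I ` p1"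
    have Dfin: "finite D" using fin by (simp add: D_def)
    have Dsub: "\<forall>(u,v)\<in>D. a \<le> u \<and> u < v \<and> v \<le> b"
      using ends by (auto simp: D_def p1_def p0_def)
    have Ddisj: "pairwise (\<lambda>(u,v) (u',v'). {u<..<v} \<inter> {u'<..<v'} = {}) D"
    proof (rule pairwiseI)
      fix A B assume "A \<in> D" "B \<in> D" "A \<noteq> B"
      then obtain t K t' K' where "(t,K) \<in> p1" "(t',K') \<in> p1" "A = (Inf K, Sup K)" "B = (Inf K', Sup K')"
        "(t,K) \<noteq> (t',K')"
        unfolding D_def by auto
      then show "(\<lambda>(u,v) (u',v'). {u<..<v} \<inter> {u'<..<v'} = {}) A B"
        using disj[of t K t' K'] by (auto simp: p1_def p0_def)
    qed
    have DG: "{u<..<v} \<subseteq> G" if uv: "(u,v) \<in> D" for u v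
    proof -
      obtain t K where K: "(t,K) \<in> p1" "u = Inf K" "v = Sup K" using uv by (auto simp: D_def)
      then have "K \<subseteq> G" "K = {u..v}" using box[of t K] by (auto simp: p1_def p0_def \<gamma>_def)
      then show ?thesis by auto
    qed
    \<comment> \<open>The intervals of \<open>D\<close> are disjoint and lie in \<open>G\<close>, so
      their total length is at most the measure of \<open>G\<close>, which is below
      \<open>\<delta>\<close>.\<close>
    have "(\<Sum>(u,v)\<in>D. v - u) = (\<Sum>A\<in>D. measure lebesgue {fst A<..<snd A})"
      using Dsub by (intro sum.cong) auto
    also have "\<dots> = measure lebesgue (\<Union>A\<in>D. {fst A<..<snd A})"
    proof (rule measure_finite_Union[symmetric])
      show "disjoint_family_on (\<lambda>A. {fst A<..<snd A}) D"
        using Ddisj unfolding disjoint_family_on_def pairwise_def by force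
      show "emeasure lebesgue {fst A<..<snd A} \<noteq> \<infinity>" if "A \<in> D" for A
        using that Dsub by auto
    qed (use Dfin in auto)
    also have "\<dots> \<le> measure lebesgue G"
    proof (rule measure_mono_fmeasurable[OF _ _ G_meas])
      show "(\<Union>A\<in>D. {fst A<..<snd A}) \<subseteq> G" using DG by (intro UN_least) (metis prod.collapse)
    qed (auto intro!: sets.finite_UN Dfin)
    finally have "(\<Sum>(u,v)\<in>D. v - u) < \<delta>" using G_small by simp
    then have "(\<Sum>(u,v)\<in>D. norm (\<phi> v - \<phi> u)) < e'" using small Dfin Dsub Ddisj by blast
    moreover have "(\<Sum>(u,v)\<in>D. norm (\<phi> v - \<phi> u)) = (\<Sum>(t,K)\<in>p1. norm (\<phi> (Sup K) - \<phi> (Inf K)))"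
      unfolding D_def sum.reindex[OF inj] by (intro sum.cong) auto
    moreover have "sum ?F p1 \<le> (\<Sum>(t,K)\<in>p1. norm (\<phi> (Sup K) - \<phi> (Inf K)))"
      by (intro sum_mono) auto
    ultimately show ?thesis by simp
  qed
  also have "sum ?F p2 \<le> (\<Sum>(t,K)\<in>p2. e' * (Sup K - Inf K))"
  proof (rule sum_mono)
    fix A assume A: "A \<in> p2"
    obtain t K where [simp]: "A = (t,K)" by (cases A)
    have tK: "(t,K) \<in> p" "t \<notin> N" using A by (auto simp: p2_def p0_def)
    note bx = box[OF tK(1)]
    then have t: "a \<le> t" "t \<le> b" "Inf K \<le> t" "t \<le> Sup K" by linarith+
    then have "\<gamma> t = ball t (d t)" using tK(2) by (simp add: \<gamma>_def)
    then have "K \<subseteq> ball t (d t)" using bx by metis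
    moreover have "Inf K \<in> K" "Sup K \<in> K" using bx by (metis atLeastAtMost_iff order_refl order_trans)+
    ultimately have "\<bar>Inf K - t\<bar> < d t" "\<bar>Sup K - t\<bar> < d t" by (auto simp: dist_real_def)
    then show "?F A \<le> (\<lambda>(t,K). e' * (Sup K - Inf K)) A"
      using d(2)[of t "Inf K" "Sup K"] tK t by simp
  qed
  also have "\<dots> \<le> (\<Sum>(t,K)\<in>p. e' * (Sup K - Inf K))"
    using e' ends(1) by (intro sum_mono2 fin) (fastforce simp: p2_def p0_def)+
  also have "\<dots> = e' * (b - a)"
    using additive_tagged_division_1[OF ab p(1), of "\<lambda>s. s"]
    by (simp add: sum_distrib_left[symmetric] case_prod_beta)
  finally show "\<phi> b \<le> \<phi> a + e" using e'e by linarith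
qed

section \<open>Closure properties of absolute continuity\<close>

text \<open>Common source of the closure properties below: the increment sums of
  \<open>\<phi>\<close> are controlled by those of \<open>h1\<close> and \<open>h2\<close>, so the
  smaller of their two thresholds serves for \<open>\<phi>\<close>.\<close>

lemma abs_cont_on_dominated:
  fixes h1 :: "real \<Rightarrow> 'b::real_normed_vector" and h2 :: "real \<Rightarrow> 'c::real_normed_vector"
    and \<phi> :: "real \<Rightarrow> 'd::real_normed_vector"
  assumes h1: "abs_cont_on a b h1" and h2: "abs_cont_on a b h2"
    and dom: "\<And>u v. a \<le> u \<Longrightarrow> u < v \<Longrightarrow> v \<le> b \<Longrightarrow>
               norm (\<phi> v - \<phi> u) \<le> K * (norm (h1 v - h1 u) + norm (h2 v - h2 u))"
  shows "abs_cont_on a b \<phi>"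
  unfolding abs_cont_on_def
proof (intro allI impI)
  fix e :: real assume e: "e > 0"
  \<comment> \<open>\<open>K\<close> has no prescribed sign; a strictly positive \<open>L\<close>
    above it permits division and strict scaling.\<close>
  define L where "L = \<bar>K\<bar> + 1"
  have L: "L > 0" "K \<le> L" by (auto simp: L_def)
  define e' where "e' = e / (2 * L)"
  have e': "e' > 0" "L * (e' + e') = e" using e L by (auto simp: e'_def field_simps)
  obtain d1 where d1: "d1 > 0" "\<And>D. finite D \<Longrightarrow> \<forall>(u,v)\<in>D. a \<le> u \<and> u < v \<and> v \<le> b \<Longrightarrow>
        pairwise (\<lambda>(u,v) (u',v'). {u<..<v} \<inter> {u'<..<v'} = {}) D \<Longrightarrow>
        (\<Sum>(u,v)\<in>D. v - u) < d1 \<Longrightarrow> (\<Sum>(u,v)\<in>D. norm (h1 v - h1 u)) < e'"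
    using h1 e' unfolding abs_cont_on_def by meson
  obtain d2 where d2: "d2 > 0" "\<And>D. finite D \<Longrightarrow> \<forall>(u,v)\<in>D. a \<le> u \<and> u < v \<and> v \<le> b \<Longrightarrow>
        pairwise (\<lambda>(u,v) (u',v'). {u<..<v} \<inter> {u'<..<v'} = {}) D \<Longrightarrow>
        (\<Sum>(u,v)\<in>D. v - u) < d2 \<Longrightarrow> (\<Sum>(u,v)\<in>D. norm (h2 v - h2 u)) < e'"
    using h2 e' unfolding abs_cont_on_def by meson
  show "\<exists>\<delta>>0. \<forall>D. finite D \<and> (\<forall>(u,v)\<in>D. a \<le> u \<and> u < v \<and> v \<le> b) \<and>
        pairwise (\<lambda>(u,v) (u',v'). {u<..<v} \<inter> {u'<..<v'} = {}) D \<and>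
        (\<Sum>(u,v)\<in>D. v - u) < \<delta> \<longrightarrow> (\<Sum>(u,v)\<in>D. norm (\<phi> v - \<phi> u)) < e"
  proof (intro exI[of _ "min d1 d2"] conjI allI impI)
    show "0 < min d1 d2" using d1 d2 by simp
    fix D assume D: "finite D \<and> (\<forall>(u,v)\<in>D. a \<le> u \<and> u < v \<and> v \<le> b) \<and>
        pairwise (\<lambda>(u,v) (u',v'). {u<..<v} \<inter> {u'<..<v'} = {}) D \<and>
        (\<Sum>(u,v)\<in>D. v - u) < min d1 d2"
    have "(\<Sum>(u,v)\<in>D. norm (\<phi> v - \<phi> u))
        \<le> (\<Sum>(u,v)\<in>D. L * (norm (h1 v - h1 u) + norm (h2 v - h2 u)))"
    proof (rule sum_mono, clarify)
      fix u v assume "(u,v) \<in> D"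
      then have "norm (\<phi> v - \<phi> u) \<le> K * (norm (h1 v - h1 u) + norm (h2 v - h2 u))"
        using D dom by blast
      also have "\<dots> \<le> L * (norm (h1 v - h1 u) + norm (h2 v - h2 u))"
        by (rule mult_right_mono) (use L in auto)
      finally show "norm (\<phi> v - \<phi> u) \<le> L * (norm (h1 v - h1 u) + norm (h2 v - h2 u))" .
    qed
    also have "\<dots> = L * ((\<Sum>(u,v)\<in>D. norm (h1 v - h1 u)) + (\<Sum>(u,v)\<in>D. norm (h2 v - h2 u)))"
      by (simp add: sum_distrib_left sum.distrib case_prod_beta distrib_left)
    also have "\<dots> < L * (e' + e')"
      using d1(2)[of D] d2(2)[of D] D L by (intro mult_strict_left_mono add_strict_mono) auto
    finally show "(\<Sum>(u,v)\<in>D. norm (\<phi> v - \<phi> u)) < e" using e' by simp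
  qed
qed

lemma abs_cont_on_ident: "abs_cont_on a b (\<lambda>t. t)"
  unfolding abs_cont_on_def
proof (intro allI impI)
  fix e :: real assume e: "e > 0"
  have "(\<Sum>(u,v)\<in>D. norm (v - u)) = (\<Sum>(u,v)\<in>D. v - u)"
    if "\<forall>(u,v)\<in>D. a \<le> u \<and> u < v \<and> v \<le> b" for D
    using that by (intro sum.cong) auto
  then show "\<exists>\<delta>>0. \<forall>D. finite D \<and> (\<forall>(u,v)\<in>D. a \<le> u \<and> u < v \<and> v \<le> b) \<and>
        pairwise (\<lambda>(u,v) (u',v'). {u<..<v} \<inter> {u'<..<v'} = {}) D \<and>
        (\<Sum>(u,v)\<in>D. v - u) < \<delta> \<longrightarrow> (\<Sum>(u,v)\<in>D. norm (v - u)) < e"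
    using e by (intro exI[of _ e]) auto
qed

lemma abs_cont_on_add:
  assumes "abs_cont_on a b h1" "abs_cont_on a b h2"
  shows "abs_cont_on a b (\<lambda>t. h1 t + h2 t)"
proof (rule abs_cont_on_dominated[OF assms, where K = 1])
  fix u v
  show "norm (h1 v + h2 v - (h1 u + h2 u)) \<le> 1 * (norm (h1 v - h1 u) + norm (h2 v - h2 u))"
    using norm_triangle_ineq[of "h1 v - h1 u" "h2 v - h2 u"] by (simp add: algebra_simps)
qed

text \<open>The increment of the product splits as in the product rule, and continuity on a compact
  interval bounds the remaining factors.\<close>

lemma abs_cont_on_inner:
  fixes h1 h2 :: "real \<Rightarrow> 'b::real_inner"
  assumes "abs_cont_on a b h1" "abs_cont_on a b h2"
    and "continuous_on {a..b} h1" "continuous_on {a..b} h2"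
  shows "abs_cont_on a b (\<lambda>t. h1 t \<bullet> h2 t)"
proof -
  obtain B1 where B1: "\<And>t. t \<in> {a..b} \<Longrightarrow> norm (h1 t) \<le> B1"
    using compact_imp_bounded[OF compact_continuous_image[OF assms(3) compact_Icc]] unfolding bounded_iff by (metis imageI)
  obtain B2 where B2: "\<And>t. t \<in> {a..b} \<Longrightarrow> norm (h2 t) \<le> B2"
    using compact_imp_bounded[OF compact_continuous_image[OF assms(4) compact_Icc]] unfolding bounded_iff by (metis imageI)
  show ?thesis
  proof (rule abs_cont_on_dominated[OF assms(1,2), where K = "max B1 B2"])
    fix u v assume uv: "a \<le> u" "u < v" "v \<le> b"
    have "h1 v \<bullet> h2 v - h1 u \<bullet> h2 u = (h1 v - h1 u) \<bullet> h2 v + h1 u \<bullet> (h2 v - h2 u)"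
      by (simp add: inner_diff)
    then have "norm (h1 v \<bullet> h2 v - h1 u \<bullet> h2 u) \<le> \<bar>(h1 v - h1 u) \<bullet> h2 v\<bar> + \<bar>h1 u \<bullet> (h2 v - h2 u)\<bar>"
      by simp
    also have "\<dots> \<le> norm (h1 v - h1 u) * norm (h2 v) + norm (h1 u) * norm (h2 v - h2 u)"
      by (intro add_mono Cauchy_Schwarz_ineq2)
    also have "\<dots> \<le> norm (h1 v - h1 u) * max B1 B2 + max B1 B2 * norm (h2 v - h2 u)"
      using B1[of u] B2[of v] uv by (intro add_mono mult_left_mono mult_right_mono) auto
    finally show "norm (h1 v \<bullet> h2 v - h1 u \<bullet> h2 u)
        \<le> max B1 B2 * (norm (h1 v - h1 u) + norm (h2 v - h2 u))"
      by (simp add: algebra_simps)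
  qed
qed

text \<open>A continuous derivative is bounded on the compact interval, so \<open>h\<close> is
  Lipschitz and is dominated by the identity, which is used for both comparison functions.\<close>

lemma abs_cont_on_C1:
  fixes h :: "real \<Rightarrow> 'b::real_normed_vector"
  assumes deriv: "\<And>t. t \<in> {a..b} \<Longrightarrow> (h has_vector_derivative h' t) (at t within {a..b})"
    and cont: "continuous_on {a..b} h'"
  shows "abs_cont_on a b h"
proof -
  obtain B where B: "\<And>t. t \<in> {a..b} \<Longrightarrow> norm (h' t) \<le> B"
    using compact_imp_bounded[OF compact_continuous_image[OF cont compact_Icc]] unfolding bounded_iff by (metis imageI)
  show ?thesis
  proof (rule abs_cont_on_dominated[OF abs_cont_on_ident abs_cont_on_ident, where K = B])
    fix u v assume uv: "a \<le> u" "u < v" "v \<le> b"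
    have "norm (h v - h u) \<le> B * norm (v - u)"
    proof (rule differentiable_bound[where S = "{a..b}" and f' = "\<lambda>t s. s *\<^sub>R h' t"])
      fix t assume t: "t \<in> {a..b}"
      show "(h has_derivative (\<lambda>s. s *\<^sub>R h' t)) (at t within {a..b})"
        using deriv[OF t] unfolding has_vector_derivative_def .
      show "onorm (\<lambda>s. s *\<^sub>R h' t) \<le> B"
        using B[OF t] by (intro onorm_le) (simp add: mult.commute[of B] mult_left_mono)
    qed (use uv in auto)
    moreover have "B \<ge> 0" using order_trans[OF norm_ge_zero B[of u]] uv by auto
    then have "0 \<le> B * norm (v - u)" by simp
    ultimately show "norm (h v - h u) \<le> B * (norm (v - u) + norm (v - u))"
      by (simp only: distrib_left)
  qed
qed

lemma abs_cont_on_subinterval: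
  assumes "abs_cont_on a b h" "a \<le> a'" "b' \<le> b"
  shows "abs_cont_on a' b' h"
  unfolding abs_cont_on_def
proof (intro allI impI)
  fix e :: real assume "e > 0"
  then obtain d where d: "d > 0" "\<And>D. finite D \<Longrightarrow> \<forall>(u,v)\<in>D. a \<le> u \<and> u < v \<and> v \<le> b \<Longrightarrow>
        pairwise (\<lambda>(u,v) (u',v'). {u<..<v} \<inter> {u'<..<v'} = {}) D \<Longrightarrow>
        (\<Sum>(u,v)\<in>D. v - u) < d \<Longrightarrow> (\<Sum>(u,v)\<in>D. norm (h v - h u)) < e"
    using assms(1) unfolding abs_cont_on_def by meson
  show "\<exists>\<delta>>0. \<forall>D. finite D \<and> (\<forall>(u,v)\<in>D. a' \<le> u \<and> u < v \<and> v \<le> b') \<and>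
        pairwise (\<lambda>(u,v) (u',v'). {u<..<v} \<inter> {u'<..<v'} = {}) D \<and>
        (\<Sum>(u,v)\<in>D. v - u) < \<delta> \<longrightarrow> (\<Sum>(u,v)\<in>D. norm (h v - h u)) < e"
  proof (intro exI[of _ d] conjI allI impI)
    fix D assume D: "finite D \<and> (\<forall>(u,v)\<in>D. a' \<le> u \<and> u < v \<and> v \<le> b') \<and>
        pairwise (\<lambda>(u,v) (u',v'). {u<..<v} \<inter> {u'<..<v'} = {}) D \<and> (\<Sum>(u,v)\<in>D. v - u) < d"
    then have "\<forall>(u,v)\<in>D. a \<le> u \<and> u < v \<and> v \<le> b" using assms(2,3) by fastforce
    then show "(\<Sum>(u,v)\<in>D. norm (h v - h u)) < e" using d(2)[of D] D by simp
  qed (rule d(1))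
qed

lemma abs_cont_on_mult:
  fixes h1 h2 :: "real \<Rightarrow> real"
  assumes "abs_cont_on a b h1" "abs_cont_on a b h2"
    and "continuous_on {a..b} h1" "continuous_on {a..b} h2"
  shows "abs_cont_on a b (\<lambda>t. h1 t * h2 t)"
  using abs_cont_on_inner[OF assms] by simp

lemma has_real_derivative_inner:
  assumes "(h1 has_vector_derivative d1) (at t within S)" "(h2 has_vector_derivative d2) (at t within S)"
  shows "((\<lambda>t. h1 t \<bullet> h2 t) has_real_derivative h1 t \<bullet> d2 + d1 \<bullet> h2 t) (at t within S)"
  using bounded_bilinear.has_vector_derivative[OF bounded_bilinear_inner assms]
  by (simp add: has_real_derivative_iff_has_vector_derivative)

section \<open>Convexity, projections and Pareto optimality\<close>

text \<open>By convexity the difference quotients from \<open>y\<close> towards \<open>z\<close> are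
  at most \<open>f z - f y\<close> for steps in (0,1); the step tends to 0 from the right.\<close>

lemma convex_on_gradient_ineq:
  fixes f :: "'a::real_inner \<Rightarrow> real"
  assumes conv: "convex_on UNIV f" and grad: "(f has_derivative (\<lambda>h. g \<bullet> h)) (at y)"
  shows "f y + g \<bullet> (z - y) \<le> f z"
proof -
  define \<psi> where "\<psi> s = f (y + s *\<^sub>R (z - y))" for s :: real
  have D: "(\<psi> has_real_derivative g \<bullet> (z - y)) (at 0)"
  proof -
    have "((\<lambda>s. y + s *\<^sub>R (z - y)) has_derivative (\<lambda>s. s *\<^sub>R (z - y))) (at 0)"
      by (auto intro!: derivative_eq_intros)
    moreover have "(f has_derivative (\<lambda>h. g \<bullet> h)) (at (y + 0 *\<^sub>R (z - y)))" using grad by simp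
    ultimately have "((\<lambda>s. f (y + s *\<^sub>R (z - y))) has_derivative (\<lambda>s. g \<bullet> (s *\<^sub>R (z - y)))) (at 0)"
      by (rule has_derivative_compose)
    moreover have "(\<lambda>s. g \<bullet> (s *\<^sub>R (z - y))) = (*) (g \<bullet> (z - y))" by (simp add: fun_eq_iff)
    ultimately show ?thesis unfolding \<psi>_def has_field_derivative_def by simp
  qed
  have "((\<lambda>s. (\<psi> s - \<psi> 0) / (s - 0)) \<longlongrightarrow> g \<bullet> (z - y)) (at_right 0)"
    using D unfolding has_field_derivative_iff by (rule filterlim_mono) (auto intro: at_le)
  moreover have "\<forall>\<^sub>F s in at_right 0. (\<psi> s - \<psi> 0) / (s - 0) \<le> f z - f y"
    unfolding eventually_at_right_field
  proof (intro exI[of _ 1] conjI allI impI)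
    fix s :: real assume s: "0 < s" "s < 1"
    have "f ((1 - s) *\<^sub>R y + s *\<^sub>R z) \<le> (1 - s) * f y + s * f z"
      using convex_onD[OF conv, of s y z] s by simp
    moreover have "(1 - s) *\<^sub>R y + s *\<^sub>R z = y + s *\<^sub>R (z - y)" by (simp add: algebra_simps)
    ultimately have "\<psi> s - \<psi> 0 \<le> s * (f z - f y)" by (simp add: \<psi>_def algebra_simps)
    then show "(\<psi> s - \<psi> 0) / (s - 0) \<le> f z - f y" using s by (simp add: field_simps)
  qed simp
  ultimately have "g \<bullet> (z - y) \<le> f z - f y"
    by (intro tendsto_upperbound) auto
  then show ?thesis by simp
qed

section \<open>Projections and the convex hull of the gradients\<close>

text \<open>Since \<open>proj\<close> is a definite description, the minimiser must first be shown
  to exist, by compactness, and to be unique, by convexity. The obtuse angle criterion then applies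
  to it.\<close>

lemma proj_compact_convex:
  fixes K :: "'a::real_inner set"
  assumes "compact K" "convex K" "K \<noteq> {}"
  shows proj_mem: "proj K y \<in> K"
    and proj_obtuse: "v \<in> K \<Longrightarrow> (y - proj K y) \<bullet> (v - proj K y) \<le> 0"
proof -
  have "continuous_on K (\<lambda>w. norm (w - y))" by (intro continuous_intros)
  then obtain w where w: "w \<in> K" "\<forall>v\<in>K. norm (w - y) \<le> norm (v - y)"
    using continuous_attains_inf[OF assms(1,3)] by blast
  have "proj K y = w" unfolding proj_def
  proof (rule the_equality)
    fix w' assume "w' \<in> K \<and> (\<forall>v\<in>K. norm (w' - y) \<le> norm (v - y))"
    then show "w' = w"
      using w any_closest_point_unique[OF assms(2) compact_imp_closed[OF assms(1)], of w' w y]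
      by (simp add: dist_norm norm_minus_commute)
  qed (use w in auto)
  then show "proj K y \<in> K" "v \<in> K \<Longrightarrow> (y - proj K y) \<bullet> (v - proj K y) \<le> 0"
    using w any_closest_point_dot[OF assms(2) compact_imp_closed[OF assms(1)], of w v y]
    by (simp_all add: dist_norm norm_minus_commute)
qed

lemma compact_Cset: "compact (Cset g x)"
  unfolding Cset_def by (rule finite_imp_compact_convex_hull) simp

lemma convex_Cset: "convex (Cset g x)"
  unfolding Cset_def by (rule convex_convex_hull)

lemma gradient_in_Cset: "g i x \<in> Cset g x"
  unfolding Cset_def by (rule hull_inc) simp

text \<open>Half-spaces are convex, so a linear bound on the gradients passes to their hull.\<close>

lemma Cset_inner_ge:
  assumes "\<xi> \<in> Cset g x" "\<And>i. c \<le> g i x \<bullet> d"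
  shows "c \<le> \<xi> \<bullet> d"
proof -
  have "Cset g x \<subseteq> {w. d \<bullet> w \<ge> c}"
    unfolding Cset_def using assms(2)
    by (intro hull_minimal convex_halfspace_ge) (auto simp: inner_commute)
  then show ?thesis using assms(1) by (auto simp: inner_commute)
qed

text \<open>If 0 were outside the hull, its element \<open>w\<close> of least norm would satisfy
  \<open>w \<bullet> w \<le> g i y \<bullet> w\<close> for every \<open>i\<close>. Then
  \<open>- w\<close> is a common descent direction, against weak optimality.\<close>

lemma weak_pareto_imp_critical:
  fixes f :: "'i::finite \<Rightarrow> 'a::real_inner \<Rightarrow> real"
  assumes grad: "\<And>i z. (f i has_derivative (\<lambda>h. g i z \<bullet> h)) (at z)"
    and wp: "y \<in> weak_pareto f"
  shows "pareto_critical g y"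
proof (rule ccontr)
  assume "\<not> pareto_critical g y"
  then have nz: "0 \<notin> Cset g y" by (simp add: pareto_critical_def)
  have ne: "Cset g y \<noteq> {}" using gradient_in_Cset by blast
  define w where "w = proj (Cset g y) 0"
  have wC: "w \<in> Cset g y" unfolding w_def by (rule proj_mem[OF compact_Cset convex_Cset ne])
  then have "w \<noteq> 0" using nz by auto
  have descent: "g i y \<bullet> (- w) < 0" for i
  proof -
    have "(0 - w) \<bullet> (g i y - w) \<le> 0"
      unfolding w_def by (rule proj_obtuse[OF compact_Cset convex_Cset ne gradient_in_Cset])
    then have "w \<bullet> w \<le> g i y \<bullet> w" by (simp add: inner_diff inner_commute)
    moreover have "w \<bullet> w > 0" using \<open>w \<noteq> 0\<close> by simp
    ultimately have "g i y \<bullet> w > 0" by linarith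
    then show ?thesis by simp
  qed
  have "\<forall>\<^sub>F s in at_right (0::real). f i (y + s *\<^sub>R (- w)) < f i y" for i
  proof -
    have "((\<lambda>s. y + s *\<^sub>R (- w)) has_derivative (\<lambda>s. s *\<^sub>R (- w))) (at 0)"
      by (auto intro!: derivative_eq_intros)
    moreover have "(f i has_derivative (\<lambda>h. g i y \<bullet> h)) (at (y + 0 *\<^sub>R (- w)))" using grad by simp
    ultimately have "((\<lambda>s. f i (y + s *\<^sub>R (- w))) has_derivative (\<lambda>s. g i y \<bullet> (s *\<^sub>R (- w)))) (at 0)"
      by (rule has_derivative_compose)
    moreover have "(\<lambda>s. g i y \<bullet> (s *\<^sub>R (- w))) = (*) (g i y \<bullet> (- w))" by (simp add: fun_eq_iff)
    ultimately have "((\<lambda>s. f i (y + s *\<^sub>R (- w))) has_real_derivative g i y \<bullet> (- w)) (at 0)"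
      unfolding has_field_derivative_def by simp
    from DERIV_neg_dec_right[OF this descent] show ?thesis
      unfolding eventually_at_right_field by force
  qed
  \<comment> \<open>As there are finitely many objectives, one step size decreases them all.\<close>
  then have "\<forall>\<^sub>F s in at_right (0::real). \<forall>i. f i (y + s *\<^sub>R (- w)) < f i y"
    by (rule eventually_all_finite)
  then obtain s where "\<forall>i. f i (y + s *\<^sub>R (- w)) < f i y"
    using eventually_happens' trivial_limit_at_right_real by blast
  then show False using wp by (auto simp: weak_pareto_def)
qed

section \<open>The merit function and weakly Pareto optimal points\<close>

lemma Min_range_le: "Min (range h) \<le> h i" for h :: "'i::finite \<Rightarrow> real"
  by (rule Min_le) auto

text \<open>This gives the real supremum in \<open>u0\<close> its intended meaning. The minimum is
  at most any one of its entries, and that entry is bounded because its objective is bounded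
  below.\<close>

lemma u0_bdd_above:
  fixes f :: "'i::finite \<Rightarrow> 'a \<Rightarrow> real"
  assumes "\<And>i. \<exists>b. \<forall>z. b \<le> f i z"
  shows "bdd_above (range (\<lambda>z. Min (range (\<lambda>i. f i y - f i z))))"
proof -
  obtain b where b: "\<And>i z. b i \<le> f i z" using assms by metis
  fix i0 :: 'i
  have "Min (range (\<lambda>i. f i y - f i z)) \<le> f i0 y - b i0" for z
    using Min_range_le[of "\<lambda>i. f i y - f i z" i0] b[of i0 z] by linarith
  then show ?thesis by (intro bdd_aboveI2)
qed

lemma u0_upper:
  fixes f :: "'i::finite \<Rightarrow> 'a \<Rightarrow> real"
  assumes "\<And>i. \<exists>b. \<forall>z. b \<le> f i z"
  shows "Min (range (\<lambda>i. f i y - f i z)) \<le> u0 f y"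
  unfolding u0_def using u0_bdd_above[of f, OF assms] by (intro cSUP_upper) auto

lemma u0_nonneg:
  fixes f :: "'i::finite \<Rightarrow> 'a \<Rightarrow> real"
  assumes "\<And>i. \<exists>b. \<forall>z. b \<le> f i z"
  shows "0 \<le> u0 f y"
  using u0_upper[of f y y, OF assms] by simp

text \<open>The tangent of \<open>f i\<close> at \<open>ybar\<close> is a weakly continuous
  minorant. If \<open>z\<close> improved on \<open>ybar\<close> by at least \<open>e\<close> in
  every objective, it would eventually improve on \<open>y n\<close> by \<open>e / 2\<close>,
  keeping \<open>u0\<close> away from 0.\<close>

lemma weak_limit_weak_pareto:
  fixes f :: "'i::finite \<Rightarrow> 'a::real_inner \<Rightarrow> real"
  assumes conv: "\<And>i. convex_on UNIV (f i)"
    and grad: "\<And>i z. (f i has_derivative (\<lambda>h. g i z \<bullet> h)) (at z)"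
    and bdd_below: "\<And>i. \<exists>b. \<forall>z. b \<le> f i z"
    and merit: "(\<lambda>n. u0 f (y n)) \<longlonglongrightarrow> 0"
    and weak: "\<And>w. (\<lambda>n. y n \<bullet> w) \<longlonglongrightarrow> ybar \<bullet> w"
  shows "ybar \<in> weak_pareto f"
proof (rule ccontr)
  assume "ybar \<notin> weak_pareto f"
  then obtain z where z: "\<And>i. f i z < f i ybar" by (auto simp: weak_pareto_def)
  define e where "e = Min (range (\<lambda>i. f i ybar - f i z))"
  have e: "e > 0" using z by (simp add: e_def)
  have e_le: "e \<le> f i ybar - f i z" for i by (simp add: e_def)
  have "\<forall>\<^sub>F n in sequentially. \<forall>i. e / 2 \<le> f i (y n) - f i z"
  proof (rule eventually_all_finite)
    fix i
    have "(\<lambda>n. y n \<bullet> g i ybar - ybar \<bullet> g i ybar) \<longlonglongrightarrow> ybar \<bullet> g i ybar - ybar \<bullet> g i ybar"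
      by (intro tendsto_diff weak tendsto_const)
    then have "\<forall>\<^sub>F n in sequentially. y n \<bullet> g i ybar - ybar \<bullet> g i ybar > - (e / 2)"
      using e by (intro order_tendstoD(1)) auto
    then show "\<forall>\<^sub>F n in sequentially. e / 2 \<le> f i (y n) - f i z"
    proof eventually_elim
      case (elim n)
      have "f i ybar + g i ybar \<bullet> (y n - ybar) \<le> f i (y n)"
        by (rule convex_on_gradient_ineq[OF conv grad])
      then show ?case using elim e_le[of i] by (simp add: inner_diff_right inner_commute)
    qed
  qed
  moreover have "\<forall>\<^sub>F n in sequentially. u0 f (y n) < e / 2"
    using merit e by (intro order_tendstoD(2)) auto
  ultimately have "\<forall>\<^sub>F n in sequentially. False"
  proof eventually_elim
    case (elim n)
    then have "e / 2 \<le> Min (range (\<lambda>i. f i (y n) - f i z))"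
      by (intro Min.boundedI) auto
    also have "\<dots> \<le> u0 f (y n)" by (rule u0_upper[of f, OF bdd_below])
    finally show False using elim by simp
  qed
  then show False by simp
qed

text \<open>This confines the comparison points to a bounded set: a weakly Pareto point below
  \<open>z\<close> is also below \<open>x0\<close>, so \<open>R\<close> bounds the infimum over its
  fibre. The infimum need not be attained, hence \<open>R + 1\<close>.\<close>

lemma pareto_representative:
  fixes f :: "'i::finite \<Rightarrow> 'a::real_normed_vector \<Rightarrow> real"
  assumes pareto_exists: "weak_pareto f \<inter> level f (\<lambda>i. f i z) \<noteq> {}"
    and R: "\<forall>Fs \<in> (\<lambda>z. (\<lambda>i. f i z)) ` (weak_pareto f \<inter> level f (\<lambda>i. f i x0)).
                     Inf {norm (z - x0)^2 / 2 | z. (\<lambda>i. f i z) = Fs} \<le> R"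
    and z: "\<And>i. f i z \<le> f i x0"
  obtains z' where "\<And>i. f i z' \<le> f i z" "(norm (z' - x0))\<^sup>2 / 2 \<le> R + 1"
proof -
  obtain w where w: "w \<in> weak_pareto f" "\<And>i. f i w \<le> f i z"
    using pareto_exists by (auto simp: level_def)
  let ?S = "{norm (v - x0)^2 / 2 | v. (\<lambda>i. f i v) = (\<lambda>i. f i w)}"
  have "w \<in> level f (\<lambda>i. f i x0)" using w z by (auto simp: level_def intro: order_trans)
  then have "Inf ?S \<le> R" using R w(1) by blast
  then have "Inf ?S < R + 1" by simp
  moreover have "?S \<noteq> {}" by blast
  ultimately obtain s where "s \<in> ?S" "s < R + 1" by (metis (no_types, lifting) cInf_lessD)
  then obtain z' where z': "(\<lambda>i. f i z') = (\<lambda>i. f i w)" "(norm (z' - x0))\<^sup>2 / 2 < R + 1" by blast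
  then have "f i z' \<le> f i z" for i using w(2)[of i] by (simp add: fun_eq_iff)
  then show ?thesis using that z'(2) by (meson less_imp_le)
qed

section \<open>Energy estimates along the trajectory\<close>

locale inertial_gradient_solution =
  fixes f :: "'i::finite \<Rightarrow> 'a::{real_inner,complete_space} \<Rightarrow> real"
    and g :: "'i \<Rightarrow> 'a \<Rightarrow> 'a"
    and \<alpha> t0 :: real and x0 :: 'a
    and x x' x'' :: "real \<Rightarrow> 'a"
  assumes conv: "\<And>i. convex_on UNIV (f i)"
    and grad: "\<And>i z. (f i has_derivative (\<lambda>h. g i z \<bullet> h)) (at z)"
    and grad_cont: "\<And>i. continuous_on UNIV (g i)"
    and alpha_pos: "\<alpha> > 0" and t0_pos: "t0 > 0"
    and sol: "is_solution g \<alpha> t0 x0 x x' x''"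
begin

text \<open>Energy lost to friction. Added to the energy it gives a nonincreasing quantity; divided
  by \<alpha> it is the integral of \<open>\<parallel>x'\<parallel>\<^sup>2 / s\<close>, the error
  term in the logarithmic bound.\<close>

definition dissipation :: "real \<Rightarrow> real" where
  "dissipation t = integral {t0..t} (\<lambda>s. \<alpha> / s * (x' s \<bullet> x' s))"

section \<open>Regularity of the trajectory and of the dissipation\<close>

lemma x_deriv_within: "t0 \<le> t \<Longrightarrow> (x has_vector_derivative x' t) (at t within {t0..})"
  using sol by (simp add: is_solution_def)

lemma x_deriv: "t0 < t \<Longrightarrow> (x has_vector_derivative x' t) (at t)"
  using x_deriv_within[of t] at_within_interior[of t "{t0..}"] by simp

lemma x'_cont: "continuous_on {t0..} x'"
  using sol by (simp add: is_solution_def)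

lemma x_cont: "continuous_on {t0..} x"
  by (auto simp: continuous_on_eq_continuous_within
      intro!: has_vector_derivative_continuous[OF x_deriv_within])

lemma x'_abs_cont: "t0 \<le> a \<Longrightarrow> abs_cont_on a b x'"
proof (cases "t0 \<le> b")
  case True
  assume "t0 \<le> a"
  then show ?thesis using sol True abs_cont_on_subinterval[of t0 b x' a b] by (simp add: is_solution_def)
next
  \<comment> \<open>Here the interval from \<open>a\<close> to \<open>b\<close> is empty, and the
    solution property is used at \<open>T = t0\<close>.\<close>
  case False
  assume "t0 \<le> a"
  then show ?thesis using sol False abs_cont_on_subinterval[of t0 t0 x' a b] by (simp add: is_solution_def)
qed

lemma x_abs_cont: "t0 \<le> a \<Longrightarrow> abs_cont_on a b x"
  by (rule abs_cont_on_C1[of a b x x'])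
    (auto intro: has_vector_derivative_within_subset[OF x_deriv_within] continuous_on_subset[OF x'_cont])

lemma initial: "x t0 = x0" "x' t0 = 0"
  using sol by (simp_all add: is_solution_def)

lemma f_x_deriv_within:
  assumes "t0 \<le> t"
  shows "((\<lambda>t. f i (x t)) has_real_derivative g i (x t) \<bullet> x' t) (at t within {t0..})"
proof -
  have "((\<lambda>t. f i (x t)) has_derivative (\<lambda>s. g i (x t) \<bullet> (s *\<^sub>R x' t))) (at t within {t0..})"
    using x_deriv_within[OF assms] unfolding has_vector_derivative_def
    by (rule has_derivative_compose[OF _ grad])
  moreover have "(\<lambda>s. g i (x t) \<bullet> (s *\<^sub>R x' t)) = (*) (g i (x t) \<bullet> x' t)" by (simp add: fun_eq_iff)
  ultimately show ?thesis unfolding has_field_derivative_def by simp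
qed

lemma f_x_deriv: "t0 < t \<Longrightarrow> ((\<lambda>t. f i (x t)) has_real_derivative g i (x t) \<bullet> x' t) (at t)"
  using f_x_deriv_within[of t i] at_within_interior[of t "{t0..}"] by simp

lemma f_x_abs_cont:
  assumes "t0 \<le> a"
  shows "abs_cont_on a b (\<lambda>t. f i (x t))"
proof (rule abs_cont_on_C1[of a b _ "\<lambda>t. g i (x t) \<bullet> x' t"])
  fix t assume "t \<in> {a..b}"
  then show "((\<lambda>t. f i (x t)) has_vector_derivative g i (x t) \<bullet> x' t) (at t within {a..b})"
    using f_x_deriv_within[of t i] assms
    by (auto simp: has_real_derivative_iff_has_vector_derivative
        intro: has_vector_derivative_within_subset)
next
  show "continuous_on {a..b} (\<lambda>t. g i (x t) \<bullet> x' t)"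
    using assms
    by (intro continuous_intros continuous_on_compose2[OF grad_cont]
        continuous_on_subset[OF x_cont] continuous_on_subset[OF x'_cont]) auto
qed

lemma dissipation_integrand_cont: "continuous_on {t0..} (\<lambda>s. \<alpha> / s * (x' s \<bullet> x' s))"
  using t0_pos by (intro continuous_intros x'_cont) auto

lemma dissipation_deriv_within:
  assumes "t0 \<le> a" "t \<in> {a..b}"
  shows "(dissipation has_real_derivative \<alpha> / t * (x' t \<bullet> x' t)) (at t within {a..b})"
proof -
  have "continuous_on {t0..b} (\<lambda>s. \<alpha> / s * (x' s \<bullet> x' s))"
    by (rule continuous_on_subset[OF dissipation_integrand_cont]) auto
  from integral_has_vector_derivative[OF this, of t] assms
  have "(dissipation has_vector_derivative \<alpha> / t * (x' t \<bullet> x' t)) (at t within {t0..b})"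
    by (auto simp: dissipation_def[abs_def])
  then show ?thesis
    using assms has_vector_derivative_within_subset[of dissipation _ t "{t0..b}" "{a..b}"]
    by (simp add: has_real_derivative_iff_has_vector_derivative)
qed

lemma dissipation_deriv:
  assumes "t0 < t"
  shows "(dissipation has_real_derivative \<alpha> / t * (x' t \<bullet> x' t)) (at t)"
  using dissipation_deriv_within[of t0 t "t + 1"] assms at_within_Icc_at[of t0 t "t + 1"] by simp

lemma dissipation_abs_cont:
  assumes "t0 \<le> a"
  shows "abs_cont_on a b dissipation"
proof (rule abs_cont_on_C1)
  fix t assume "t \<in> {a..b}"
  then show "(dissipation has_vector_derivative \<alpha> / t * (x' t \<bullet> x' t)) (at t within {a..b})"
    using dissipation_deriv_within[of a t b] assms
    by (simp add: has_real_derivative_iff_has_vector_derivative)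
next
  show "continuous_on {a..b} (\<lambda>t. \<alpha> / t * (x' t \<bullet> x' t))"
    by (rule continuous_on_subset[OF dissipation_integrand_cont]) (use assms in auto)
qed

lemma dissipation_t0: "dissipation t0 = 0"
  by (simp add: dissipation_def)

lemma dissipation_mono:
  assumes "t0 \<le> s" "s \<le> t"
  shows "dissipation s \<le> dissipation t"
proof -
  have "(\<lambda>s. \<alpha> / s * (x' s \<bullet> x' s)) integrable_on {t0..r}" for r
    by (rule integrable_continuous_real, rule continuous_on_subset[OF dissipation_integrand_cont]) auto
  then show ?thesis
    unfolding dissipation_def using assms t0_pos alpha_pos by (intro integral_subset_le) auto
qed

section \<open>Lyapunov estimates from the differential equation\<close>

text \<open>The equation says that the projection of 0 onto \<open>C(x) + x''\<close> is
  \<open>- (\<alpha>/t) x'\<close>. Membership of this point gives the last claim; the obtuse angle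
  inequality tested with \<open>g i (x t) + x'' t\<close>, divided by
  \<open>\<alpha> / t > 0\<close>, gives the estimate for each objective.\<close>

lemma AE_dynamics:
  "AE t in lborel. t0 < t \<longrightarrow>
     (x' has_vector_derivative x'' t) (at t) \<and>
     (\<forall>i. x' t \<bullet> g i (x t) + x' t \<bullet> x'' t \<le> - (\<alpha> / t) * (x' t \<bullet> x' t)) \<and>
     - (x'' t + (\<alpha> / t) *\<^sub>R x' t) \<in> Cset g (x t)"
proof -
  have A: "AE t in lborel. t > t0 \<longrightarrow> (x' has_vector_derivative x'' t) (at t)"
    and B: "AE t in lborel. t > t0 \<longrightarrow>
        (\<alpha> / t) *\<^sub>R x' t + proj ((\<lambda>c. c + x'' t) ` Cset g (x t)) 0 = 0"
    using sol by (auto simp: is_solution_def)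
  from A B show ?thesis
  proof eventually_elim
    case (elim t)
    show ?case
    proof (intro impI conjI allI)
      assume t: "t0 < t"
      then show "(x' has_vector_derivative x'' t) (at t)" using elim by blast
      define K where "K = (\<lambda>c. c + x'' t) ` Cset g (x t)"
      have p: "proj K 0 = - ((\<alpha> / t) *\<^sub>R x' t)"
        using elim(2) t unfolding K_def by (simp add: eq_neg_iff_add_eq_0 add.commute)
      have K: "compact K" "convex K" "K \<noteq> {}"
      proof -
        show "compact K" unfolding K_def
          by (intro compact_continuous_image compact_Cset continuous_intros)
        show "convex K" unfolding K_def
          using convex_translation[OF convex_Cset, of "x'' t"] by (simp add: add.commute)
        show "K \<noteq> {}" unfolding K_def using gradient_in_Cset by blast
      qed
      show "- (x'' t + (\<alpha> / t) *\<^sub>R x' t) \<in> Cset g (x t)"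
      proof -
        obtain \<xi> where "\<xi> \<in> Cset g (x t)" "proj K 0 = \<xi> + x'' t"
          using proj_mem[OF K, of 0] unfolding K_def by blast
        then show ?thesis using p by (metis add_diff_cancel_right' diff_conv_add_uminus minus_add)
      qed
      fix i
      have "g i (x t) + x'' t \<in> K" unfolding K_def using gradient_in_Cset by blast
      from proj_obtuse[OF K this, of 0]
      have "(\<alpha> / t) * (x' t \<bullet> (g i (x t) + x'' t + (\<alpha> / t) *\<^sub>R x' t)) \<le> 0"
        unfolding p by (simp add: algebra_simps)
      moreover have "\<alpha> / t > 0" using alpha_pos t0_pos t by simp
      ultimately have "x' t \<bullet> (g i (x t) + x'' t + (\<alpha> / t) *\<^sub>R x' t) \<le> 0"
        by (meson mult_pos_pos not_le)
      then show "x' t \<bullet> g i (x t) + x' t \<bullet> x'' t \<le> - (\<alpha> / t) * (x' t \<bullet> x' t)"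
        by (simp add: inner_add_right)
    qed
  qed
qed

text \<open>The estimate of \<open>AE_dynamics\<close> makes the derivative nonpositive almost
  everywhere; since \<open>x''\<close> exists only almost everywhere, absolute continuity is what
  turns this into monotonicity.\<close>

lemma energy_dissipation:
  assumes "t0 \<le> s" "s \<le> t"
  shows "f i (x t) + x' t \<bullet> x' t / 2 + dissipation t \<le> f i (x s) + x' s \<bullet> x' s / 2 + dissipation s"
proof -
  define \<phi> where "\<phi> r = f i (x r) + (1 / 2) * (x' r \<bullet> x' r) + dissipation r" for r
  have cont: "continuous_on {s..t} x'"
    using assms by (intro continuous_on_subset[OF x'_cont]) auto
  have "abs_cont_on s t (\<lambda>r. 1 / 2 :: real)"
    by (rule abs_cont_on_C1[of _ _ _ "\<lambda>_. 0"]) auto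
  then have "abs_cont_on s t \<phi>"
    unfolding \<phi>_def
    by (intro abs_cont_on_add abs_cont_on_mult abs_cont_on_inner f_x_abs_cont dissipation_abs_cont
        x'_abs_cont cont assms continuous_intros)
  moreover have "AE r in lborel. s < r \<and> r < t \<longrightarrow> (\<exists>D\<le>0. (\<phi> has_real_derivative D) (at r))"
    using AE_dynamics
  proof eventually_elim
    case (elim r)
    show ?case
    proof (intro impI)
      assume "s < r \<and> r < t"
      then have r: "t0 < r" using assms by simp
      then have dx': "(x' has_vector_derivative x'' r) (at r)"
        and le: "x' r \<bullet> g i (x r) + x' r \<bullet> x'' r \<le> - (\<alpha> / r) * (x' r \<bullet> x' r)"
        using elim by blast+
      have "(\<phi> has_real_derivative
              g i (x r) \<bullet> x' r + (1 / 2) * (x' r \<bullet> x'' r + x'' r \<bullet> x' r) + \<alpha> / r * (x' r \<bullet> x' r)) (at r)"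
        unfolding \<phi>_def
        by (intro DERIV_add DERIV_cmult f_x_deriv dissipation_deriv has_real_derivative_inner dx' r)
      moreover have "g i (x r) \<bullet> x' r + (1 / 2) * (x' r \<bullet> x'' r + x'' r \<bullet> x' r) + \<alpha> / r * (x' r \<bullet> x' r) \<le> 0"
        using le by (simp add: inner_commute)
      ultimately show "\<exists>D\<le>0. (\<phi> has_real_derivative D) (at r)" by blast
    qed
  qed
  ultimately have "\<phi> t \<le> \<phi> s"
    using abs_cont_on_AE_deriv_nonpos_imp_le assms by blast
  then show ?thesis by (simp add: \<phi>_def)
qed

text \<open>The right-hand side depends on \<open>z\<close> only through its distance to
  \<open>x0\<close> and, for fixed \<open>M\<close>, not on \<open>T\<close>, so \<open>c\<close> is
  forced down at the rate \<open>1 / ln T\<close>.\<close>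

lemma merit_log_bound:
  assumes T: "t0 \<le> T"
    and c: "\<And>i. c \<le> f i (x T) - f i z + x' T \<bullet> x' T / 2"
    and M: "x' T \<bullet> x' T / 2 \<le> M" "dissipation T \<le> M"
  shows "c * ln (T / t0) \<le> (1 + \<alpha>) * (norm (z - x0))\<^sup>2 / (2 * t0\<^sup>2) + 3 / (2 * \<alpha>) * M + M"
proof -
  \<comment> \<open>With \<open>h = \<parallel>x - z\<parallel>\<^sup>2 / 2\<close> this is \<open>h'/t + (1 + \<alpha>) h/t\<^sup>2 + c ln (t/t0)\<close> minus the integral of
    \<open>3 \<parallel>x'\<parallel>\<^sup>2 / (2 t)\<close>; it decreases because \<open>h'' + (\<alpha>/t) h' + c \<le> 3/2 \<parallel>x'\<parallel>\<^sup>2\<close>.\<close>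
  define \<phi> where "\<phi> t = (1 / t) * ((x t - z) \<bullet> x' t)
      + ((1 + \<alpha>) / (2 * t\<^sup>2)) * ((x t - z) \<bullet> (x t - z))
      + (c * ln (t / t0) - 3 / (2 * \<alpha>) * dissipation t)" for t
  have cont: "continuous_on {t0..T} x'" "continuous_on {t0..T} (\<lambda>t. x t - z)"
    by (auto intro!: continuous_intros continuous_on_subset[OF x'_cont] continuous_on_subset[OF x_cont])
  have inv: "continuous_on {t0..T} (\<lambda>t. 1 / t)" "continuous_on {t0..T} (\<lambda>t. (1 + \<alpha>) / (2 * t\<^sup>2))"
    "continuous_on {t0..T} (\<lambda>t. - (1 / t\<^sup>2))" "continuous_on {t0..T} (\<lambda>t. - ((1 + \<alpha>) / t ^ 3))"
    using t0_pos by (auto intro!: continuous_intros)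
  have d1: "((\<lambda>t. 1 / t) has_real_derivative - (1 / t\<^sup>2)) (at t within S)" if "t \<ge> t0" for t S
    using that t0_pos by (auto intro!: derivative_eq_intros simp: field_simps power2_eq_square)
  have d2: "((\<lambda>t. (1 + \<alpha>) / (2 * t\<^sup>2)) has_real_derivative - ((1 + \<alpha>) / t ^ 3)) (at t within S)"
    if "t \<ge> t0" for t S
    using that t0_pos
    by (auto intro!: derivative_eq_intros simp: divide_simps power2_eq_square power3_eq_cube)
  have d3: "((\<lambda>t. c * ln (t / t0)) has_real_derivative c / t) (at t within S)" if "t \<ge> t0" for t S
    using that t0_pos by (auto intro!: derivative_eq_intros simp: field_simps)
  have ac1: "abs_cont_on t0 T (\<lambda>t. 1 / t)"
    by (rule abs_cont_on_C1[OF _ inv(3)])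
      (simp add: d1 flip: has_real_derivative_iff_has_vector_derivative)
  have ac2: "abs_cont_on t0 T (\<lambda>t. (1 + \<alpha>) / (2 * t\<^sup>2))"
    by (rule abs_cont_on_C1[OF _ inv(4)])
      (simp add: d2 flip: has_real_derivative_iff_has_vector_derivative)
  have ac3: "abs_cont_on t0 T (\<lambda>t. c * ln (t / t0) - 3 / (2 * \<alpha>) * dissipation t)"
  proof (rule abs_cont_on_C1)
    fix t assume "t \<in> {t0..T}"
    then show "((\<lambda>t. c * ln (t / t0) - 3 / (2 * \<alpha>) * dissipation t) has_vector_derivative
        c / t - 3 / (2 * \<alpha>) * (\<alpha> / t * (x' t \<bullet> x' t))) (at t within {t0..T})"
      unfolding has_real_derivative_iff_has_vector_derivative[symmetric]
      by (intro DERIV_diff DERIV_cmult d3 dissipation_deriv_within) auto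
  next
    show "continuous_on {t0..T} (\<lambda>t. c / t - 3 / (2 * \<alpha>) * (\<alpha> / t * (x' t \<bullet> x' t)))"
      using t0_pos by (intro continuous_intros cont) auto
  qed
  have "abs_cont_on t0 T (\<lambda>t. - z)" by (rule abs_cont_on_C1[of _ _ _ "\<lambda>_. 0"]) auto
  then have acx: "abs_cont_on t0 T (\<lambda>t. x t - z)"
    using abs_cont_on_add[OF x_abs_cont[of t0 T], of "\<lambda>t. - z"] by simp
  have "abs_cont_on t0 T \<phi>"
    unfolding \<phi>_def
    by (intro abs_cont_on_add abs_cont_on_mult abs_cont_on_inner ac1 ac2 ac3 acx x'_abs_cont cont inv
        continuous_on_inner order_refl)
  moreover have "AE t in lborel. t0 < t \<and> t < T \<longrightarrow> (\<exists>D\<le>0. (\<phi> has_real_derivative D) (at t))"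
    using AE_dynamics
  proof eventually_elim
    case (elim t)
    show ?case
    proof (intro impI)
      assume t: "t0 < t \<and> t < T"
      then have tpos: "t > 0" "t0 < t" "t0 \<le> t" using t0_pos by auto
      have dx': "(x' has_vector_derivative x'' t) (at t)"
        and \<xi>: "- (x'' t + (\<alpha> / t) *\<^sub>R x' t) \<in> Cset g (x t)"
        using elim t by blast+
      define y where "y = x t - z"
      have dy: "((\<lambda>t. x t - z) has_vector_derivative x' t) (at t)"
        using has_vector_derivative_diff[OF x_deriv[OF tpos(2)] has_vector_derivative_const, of z] by simp
      define D where "D = (1 / t) * (y \<bullet> x'' t + x' t \<bullet> x' t) + - (1 / t\<^sup>2) * (y \<bullet> x' t)
          + ((1 + \<alpha>) / (2 * t\<^sup>2) * (y \<bullet> x' t + x' t \<bullet> y) + - ((1 + \<alpha>) / t ^ 3) * (y \<bullet> y))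
          + (c / t - 3 / (2 * \<alpha>) * (\<alpha> / t * (x' t \<bullet> x' t)))"
      have "(\<phi> has_real_derivative D) (at t)"
        unfolding \<phi>_def D_def y_def
        by (intro DERIV_add DERIV_diff DERIV_mult' DERIV_cmult d1 d2 d3 dissipation_deriv
            has_real_derivative_inner dx' dy tpos)
      \<comment> \<open>The bound \<open>c\<close> is assumed at time \<open>T\<close>; monotonicity
        of the energy carries it back to \<open>t\<close>. Convexity turns it into a bound on each
        gradient, and hence on the element of the hull given by the dynamics.\<close>
      moreover have "c - x' t \<bullet> x' t / 2 \<le> - (x'' t + (\<alpha> / t) *\<^sub>R x' t) \<bullet> y"
      proof (rule Cset_inner_ge[OF \<xi>])
        fix i
        have "f i (x t) + g i (x t) \<bullet> (z - x t) \<le> f i z"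
          by (rule convex_on_gradient_ineq[OF conv grad])
        then have "f i (x t) - f i z \<le> g i (x t) \<bullet> y" by (simp add: y_def inner_diff_right)
        moreover have "f i (x T) + x' T \<bullet> x' T / 2 + dissipation T
            \<le> f i (x t) + x' t \<bullet> x' t / 2 + dissipation t"
          using energy_dissipation t by simp
        moreover have "dissipation t \<le> dissipation T" using dissipation_mono t by simp
        ultimately show "c - x' t \<bullet> x' t / 2 \<le> g i (x t) \<bullet> y" using c[of i] by simp
      qed
      then have *: "y \<bullet> x'' t + (\<alpha> / t) * (y \<bullet> x' t) + c - x' t \<bullet> x' t / 2 \<le> 0"
        by (simp add: inner_commute inner_add_right inner_diff_right)
      \<comment> \<open>The coefficients of \<open>\<phi>\<close> are tuned for this:
        \<open>- 1 + (1 + \<alpha>)\<close> leaves the damping term \<alpha>, and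
        \<open>1 - 3/2\<close> leaves \<open>- 1/2\<close> of
        \<open>\<parallel>x'\<parallel>\<^sup>2\<close>. Differentiating
        \<open>1 / t\<^sup>2\<close> leaves a nonpositive remainder.\<close>
      have "D = (1 / t) * (y \<bullet> x'' t + (\<alpha> / t) * (y \<bullet> x' t) + c - x' t \<bullet> x' t / 2)
          - ((1 + \<alpha>) / t ^ 3) * (y \<bullet> y)"
      proof -
        have "3 / (2 * \<alpha>) * (\<alpha> / t * (x' t \<bullet> x' t)) = (1 / t) * (3 * (x' t \<bullet> x' t) / 2)"
          using alpha_pos by simp
        moreover have "(1 + \<alpha>) / (2 * t\<^sup>2) * (y \<bullet> x' t + x' t \<bullet> y)
            = 1 / t\<^sup>2 * (y \<bullet> x' t) + (1 / t) * ((\<alpha> / t) * (y \<bullet> x' t))"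
          by (simp add: inner_commute[of "x' t" y] add_divide_distrib distrib_right power2_eq_square)
        ultimately show ?thesis
          unfolding D_def by (simp add: algebra_simps flip: add_divide_distrib diff_divide_distrib)
      qed
      moreover have "\<dots> \<le> 0"
      proof -
        have "(1 / t) * (y \<bullet> x'' t + (\<alpha> / t) * (y \<bullet> x' t) + c - x' t \<bullet> x' t / 2) \<le> 0"
          using * tpos by (intro mult_nonneg_nonpos) auto
        moreover have "((1 + \<alpha>) / t ^ 3) * (y \<bullet> y) \<ge> 0" using tpos alpha_pos by simp
        ultimately show ?thesis by linarith
      qed
      ultimately show "\<exists>D\<le>0. (\<phi> has_real_derivative D) (at t)" by metis
    qed
  qed
  ultimately have "\<phi> T \<le> \<phi> t0"
    using abs_cont_on_AE_deriv_nonpos_imp_le T by blast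
  moreover have "\<phi> t0 = (1 + \<alpha>) * (norm (z - x0))\<^sup>2 / (2 * t0\<^sup>2)"
    using t0_pos by (simp add: \<phi>_def initial dissipation_t0 power2_norm_eq_inner[symmetric] norm_minus_commute)
  \<comment> \<open>The term \<open>h'/T\<close> has no sign; completing the square with
    \<open>h/T\<^sup>2\<close> bounds their sum below by
    \<open>- \<parallel>x'\<parallel>\<^sup>2 / 2 \<ge> - M\<close>, and the extra
    \<open>\<alpha> h/T\<^sup>2\<close> only helps.\<close>
  moreover have "\<phi> T \<ge> - M + (c * ln (T / t0) - 3 / (2 * \<alpha>) * M)"
  proof -
    define y where "y = x T - z"
    have Tpos: "T > 0" using T t0_pos by simp
    have "0 \<le> (x' T + (1 / T) *\<^sub>R y) \<bullet> (x' T + (1 / T) *\<^sub>R y)" by simp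
    also have "\<dots> = x' T \<bullet> x' T + 2 * ((1 / T) * (y \<bullet> x' T)) + (y \<bullet> y) / T\<^sup>2"
      by (simp add: inner_add inner_commute power2_eq_square)
    finally have "(1 / T) * (y \<bullet> x' T) + (y \<bullet> y) / (2 * T\<^sup>2) \<ge> - M" using M(1) by simp
    moreover have "(1 + \<alpha>) / (2 * T\<^sup>2) * (y \<bullet> y) \<ge> (y \<bullet> y) / (2 * T\<^sup>2)"
      using alpha_pos by (simp add: divide_right_mono mult_right_mono distrib_right)
    moreover have "3 / (2 * \<alpha>) * dissipation T \<le> 3 / (2 * \<alpha>) * M"
      using M(2) alpha_pos by (intro mult_left_mono) auto
    ultimately show ?thesis unfolding \<phi>_def y_def[symmetric] by linarith
  qed
  ultimately show ?thesis by linarith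
qed

end

section \<open>Decay of the merit function and criticality of weak limit points\<close>

theorem theorem4p7:
  fixes f :: "'i::finite \<Rightarrow> 'a::{real_inner,complete_space} \<Rightarrow> real"
    and g :: "'i \<Rightarrow> 'a \<Rightarrow> 'a"
    and \<alpha> t0 :: real and x0 :: 'a
    and x x' x'' :: "real \<Rightarrow> 'a"
  assumes conv: "\<And>i. convex_on UNIV (f i)"
    and grad: "\<And>i z. (f i has_derivative (\<lambda>h. g i z \<bullet> h)) (at z)"
    and grad_cont: "\<And>i. continuous_on UNIV (g i)"
    and bdd_below: "\<And>i. \<exists>b. \<forall>z. b \<le> f i z"
    and alpha_pos: "\<alpha> > 0" and t0_pos: "t0 > 0"
    and sol: "is_solution g \<alpha> t0 x0 x x' x''"
    and pareto_exists: "\<And>y0 y. y \<in> level f (\<lambda>i. f i y0) \<Longrightarrow>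
                          weak_pareto f \<inter> level f (\<lambda>i. f i y) \<noteq> {}"
    and R_finite: "\<exists>R. \<forall>Fs \<in> (\<lambda>z. (\<lambda>i. f i z)) ` (weak_pareto f \<inter> level f (\<lambda>i. f i x0)).
                     Inf {norm (z - x0)^2 / 2 | z. (\<lambda>i. f i z) = Fs} \<le> R"
  shows "((\<lambda>t. u0 f (x t) + norm (x' t)^2 / 2) \<longlongrightarrow> 0) at_top \<and>
         ((\<lambda>t. u0 f (x t)) \<longlongrightarrow> 0) at_top \<and>
         (\<forall>xbar s. filterlim s at_top sequentially \<and>
            (\<forall>y. (\<lambda>n. x (s n) \<bullet> y) \<longlonglongrightarrow> xbar \<bullet> y) \<longrightarrow>
            pareto_critical g xbar)"
proof -
  interpret inertial_gradient_solution f g \<alpha> t0 x0 x x' x''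
    by unfold_locales (fact conv grad grad_cont alpha_pos t0_pos sol)+
  let ?W = "\<lambda>t. u0 f (x t) + norm (x' t)^2 / 2"
  obtain R where R: "\<forall>Fs \<in> (\<lambda>z. (\<lambda>i. f i z)) ` (weak_pareto f \<inter> level f (\<lambda>i. f i x0)).
                     Inf {norm (z - x0)^2 / 2 | z. (\<lambda>i. f i z) = Fs} \<le> R"
    using R_finite by blast
  fix i0 :: 'i
  obtain b where b: "\<And>z. b \<le> f i0 z" using bdd_below by blast
  \<comment> \<open>The initial energy of one objective above its lower bound; it caps both the
    kinetic energy and the dissipation for all times.\<close>
  define M where "M = f i0 x0 - b"
  have decrease: "f i (x t) + x' t \<bullet> x' t / 2 + dissipation t \<le> f i x0" if "t0 \<le> t" for i t
    using energy_dissipation[OF order_refl that, of i] by (simp add: initial dissipation_t0)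
  have dissipation_nonneg: "0 \<le> dissipation t" if "t0 \<le> t" for t
    using dissipation_mono[OF order_refl that] by (simp add: dissipation_t0)
  have M: "x' t \<bullet> x' t / 2 \<le> M" "dissipation t \<le> M" if "t0 \<le> t" for t
    using decrease[OF that, of i0] dissipation_nonneg[OF that] b[of "x t"] inner_ge_zero[of "x' t"]
    unfolding M_def by linarith+
  \<comment> \<open>The bound of \<open>merit_log_bound\<close> with
    \<open>(norm (z' - x0))\<^sup>2 / 2\<close> replaced by \<open>R + 1\<close>.\<close>
  define C where "C = (1 + \<alpha>) * (R + 1) / t0\<^sup>2 + 3 / (2 * \<alpha>) * M + M"
  have W_bound: "?W t \<le> C / ln (t / t0)" if t: "t0 < t" for t
  proof -
    have ln_pos: "ln (t / t0) > 0" using t t0_pos by simp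
    \<comment> \<open>A nonnegative minimum puts \<open>z\<close> below \<open>x t\<close>, hence
      below \<open>x0\<close> in every objective, so a representative near \<open>x0\<close> exists.
      Passing to it can only raise the differences \<open>f i (x t) - f i z\<close>.\<close>
    have key: "Min (range (\<lambda>i. f i (x t) - f i z)) + x' t \<bullet> x' t / 2 \<le> C / ln (t / t0)"
      if z: "Min (range (\<lambda>i. f i (x t) - f i z)) \<ge> 0" for z
    proof -
      have "f i z \<le> f i x0" for i
        using z Min_range_le[of "\<lambda>i. f i (x t) - f i z" i] decrease[of t i] dissipation_nonneg[of t]
          inner_ge_zero[of "x' t"] t by linarith
      then obtain z' where z': "\<And>i. f i z' \<le> f i z" "(norm (z' - x0))\<^sup>2 / 2 \<le> R + 1"
        using pareto_representative[OF pareto_exists[of z z] R] by (auto simp: level_def)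
      let ?c = "Min (range (\<lambda>i. f i (x t) - f i z)) + x' t \<bullet> x' t / 2"
      have "?c \<le> f i (x t) - f i z' + x' t \<bullet> x' t / 2" for i
      proof -
        show ?thesis using Min_range_le[of "\<lambda>i. f i (x t) - f i z" i] z'(1)[of i] by linarith
      qed
      from merit_log_bound[OF _ this M] t
      have "?c * ln (t / t0) \<le> (1 + \<alpha>) * (norm (z' - x0))\<^sup>2 / (2 * t0\<^sup>2) + 3 / (2 * \<alpha>) * M + M"
        by simp
      also have "(1 + \<alpha>) * (norm (z' - x0))\<^sup>2 / (2 * t0\<^sup>2) = (1 + \<alpha>) * ((norm (z' - x0))\<^sup>2 / 2) / t0\<^sup>2"
        by simp
      also have "\<dots> \<le> (1 + \<alpha>) * (R + 1) / t0\<^sup>2"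
        using z'(2) alpha_pos by (intro divide_right_mono mult_left_mono) auto
      finally show ?thesis using ln_pos by (simp add: C_def pos_le_divide_eq)
    qed
    have "Min (range (\<lambda>i. f i (x t) - f i z)) \<le> C / ln (t / t0) - x' t \<bullet> x' t / 2" for z
    proof (cases "Min (range (\<lambda>i. f i (x t) - f i z)) \<ge> 0")
      case True
      then show ?thesis using key[of z] by linarith
    next
      case False
      \<comment> \<open>With \<open>z = x t\<close> the minimum is 0, so \<open>key\<close> bounds
        the kinetic energy alone; a negative minimum then only lowers the left-hand side.\<close>
      have "x' t \<bullet> x' t / 2 \<le> C / ln (t / t0)" using key[of "x t"] by simp
      then show ?thesis using False by linarith
    qed
    then have "u0 f (x t) \<le> C / ln (t / t0) - x' t \<bullet> x' t / 2"
      unfolding u0_def by (intro cSUP_least) auto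
    then show ?thesis by (simp add: power2_norm_eq_inner)
  qed
  have ln_lim: "((\<lambda>t. C / ln (t / t0)) \<longlongrightarrow> 0) at_top"
  proof (rule tendsto_divide_0[OF tendsto_const])
    have "LIM t at_top. t / t0 :> at_top"
      using filterlim_tendsto_pos_mult_at_top[OF tendsto_const, of "1 / t0" "\<lambda>t. t"] t0_pos
      by (simp add: filterlim_ident)
    then have "LIM t at_top. ln (t / t0) :> at_top" by (rule filterlim_compose[OF ln_at_top])
    then show "LIM t at_top. ln (t / t0) :> at_infinity" by (rule filterlim_at_top_imp_at_infinity)
  qed
  have W_lim: "(?W \<longlongrightarrow> 0) at_top"
  proof (rule tendsto_sandwich[OF _ _ tendsto_const ln_lim])
    show "\<forall>\<^sub>F t in at_top. 0 \<le> ?W t" using u0_nonneg[of f, OF bdd_below] by simp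
    show "\<forall>\<^sub>F t in at_top. ?W t \<le> C / ln (t / t0)"
      using eventually_gt_at_top[of t0] by eventually_elim (rule W_bound)
  qed
  have u0_lim: "((\<lambda>t. u0 f (x t)) \<longlongrightarrow> 0) at_top"
    by (rule tendsto_sandwich[OF _ _ tendsto_const W_lim]) (simp_all add: u0_nonneg[of f, OF bdd_below])
  have "pareto_critical g xbar"
    if "filterlim s at_top sequentially" "\<forall>y. (\<lambda>n. x (s n) \<bullet> y) \<longlonglongrightarrow> xbar \<bullet> y" for xbar s
  proof (rule weak_pareto_imp_critical[of f g, OF grad])
    have "(\<lambda>n. u0 f (x (s n))) \<longlonglongrightarrow> 0" using filterlim_compose[OF u0_lim that(1)] .
    then show "xbar \<in> weak_pareto f"
      using that(2) by (intro weak_limit_weak_pareto[of f g, OF conv grad bdd_below]) auto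
  qed
  then show ?thesis using W_lim u0_lim by blast
qed

end
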